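(* For a tight twisted product $T=M\times_\Phi^qS$, the following are equivalent: (i) $T$ is regular; (ii) $M$ and $S$ are both regular, and either $q$ is a unit of $M$ or else $\Phi(D)=0$ for every $\mathscr D$-class $D$ of $S$.
   Context: $S$ is a monoid (multiplicative, identity $1$); $M$ is a commutative monoid (additive, identity $0$); $q\in M$ is fixed; $\mathbb N=\{0,1,2,\dots\}$. A twisting of $S$ is a map $\Phi:S\times S\to\mathbb N$ with $\Phi(a,b)+\Phi(ab,c)=\Phi(a,bc)+\Phi(b,c)$ for all $a,b,c\in S$. It is tight if (a) for all $a,b\in S$ there is $a'\in S$ with $ab=a'b$ and $\Phi(a',b)=0$; and (b) for all $a,b\in S$ there is $b'\in S$ with $ab=ab'$ and $\Phi(a,b')=0$. The twisted product $M\times_\Phi^qS$ is the semigroup with underlying set $M\times S$ and product $(i,a)(j,b)=(i+j+\Phi(a,b)q,\,ab)$, where for $n\in\mathbb N$, $nq$ is the $n$-fold sum of $q$ in $M$ (and $0q=0$); it is called tight if $\Phi$ is tight (in which case it is a monoid with identity $(0,1)$). A semigroup $X$ is regular if $a\in aXa$ for every $a\in X$. $\mathscr D=\mathscr L\vee\mathscr R$ on $S$, with $a\,\mathscr L\,b\iff Sa=Sb$ and $a\,\mathscr R\,b\iff aS=bS$. For a regular $\mathscr D$-class $D$ of $S$ (all of whose elements are regular), $\Phi(D)=\min\{\Phi(e,e):e\in D,\ e^2=e\}$. *)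

theory Defs
  imports "HOL-Algebra.Coset"
begin

definition regular_semigroup :: "('a, 'x) monoid_scheme \<Rightarrow> bool" where
  "regular_semigroup X \<longleftrightarrow>
     (\<forall>a\<in>carrier X. \<exists>x\<in>carrier X. a = a \<otimes>\<^bsub>X\<^esub> x \<otimes>\<^bsub>X\<^esub> a)"

definition green_L :: "('a, 'x) monoid_scheme \<Rightarrow> ('a \<times> 'a) set" where
  "green_L S = {(a, b) \<in> carrier S \<times> carrier S. carrier S #>\<^bsub>S\<^esub> a = carrier S #>\<^bsub>S\<^esub> b}"

definition green_R :: "('a, 'x) monoid_scheme \<Rightarrow> ('a \<times> 'a) set" where
  "green_R S = {(a, b) \<in> carrier S \<times> carrier S. a <#\<^bsub>S\<^esub> carrier S = b <#\<^bsub>S\<^esub> carrier S}"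

(* The join is taken in the lattice of equivalence relations on the carrier. *)
definition green_D :: "('a, 'x) monoid_scheme \<Rightarrow> ('a \<times> 'a) set" where
  "green_D S = \<Inter> {E. equiv (carrier S) E \<and> green_L S \<union> green_R S \<subseteq> E}"

definition twisting :: "('s, 'x) monoid_scheme \<Rightarrow> ('s \<Rightarrow> 's \<Rightarrow> nat) \<Rightarrow> bool" where
  "twisting S \<Phi> \<longleftrightarrow>
     (\<forall>a\<in>carrier S. \<forall>b\<in>carrier S. \<forall>c\<in>carrier S.
        \<Phi> a b + \<Phi> (a \<otimes>\<^bsub>S\<^esub> b) c = \<Phi> a (b \<otimes>\<^bsub>S\<^esub> c) + \<Phi> b c)"

definition tight_twisting :: "('s, 'x) monoid_scheme \<Rightarrow> ('s \<Rightarrow> 's \<Rightarrow> nat) \<Rightarrow> bool" where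
  "tight_twisting S \<Phi> \<longleftrightarrow> twisting S \<Phi> \<and>
     (\<forall>a\<in>carrier S. \<forall>b\<in>carrier S. \<exists>a'\<in>carrier S. a \<otimes>\<^bsub>S\<^esub> b = a' \<otimes>\<^bsub>S\<^esub> b \<and> \<Phi> a' b = 0) \<and>
     (\<forall>a\<in>carrier S. \<forall>b\<in>carrier S. \<exists>b'\<in>carrier S. a \<otimes>\<^bsub>S\<^esub> b = a \<otimes>\<^bsub>S\<^esub> b' \<and> \<Phi> a b' = 0)"

(* M is written multiplicatively here, so the term i + j + \<Phi>(a,b)q of the usual additive notation
   becomes i \<otimes> j \<otimes> q [^] \<Phi> a b. The field one is an identity when \<Phi> is tight, but not for an
   arbitrary twisting, where the product is only a semigroup. *)
definition twisted_product ::
  "('m, 'x) monoid_scheme \<Rightarrow> 'm \<Rightarrow> ('s \<Rightarrow> 's \<Rightarrow> nat) \<Rightarrow> ('s, 'y) monoid_scheme \<Rightarrow> ('m \<times> 's) monoid"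
where
  "twisted_product M q \<Phi> S =
     \<lparr>carrier = carrier M \<times> carrier S,
      mult = (\<lambda>(i, a) (j, b). (i \<otimes>\<^bsub>M\<^esub> j \<otimes>\<^bsub>M\<^esub> q [^]\<^bsub>M\<^esub> \<Phi> a b, a \<otimes>\<^bsub>S\<^esub> b)),
      one = (\<one>\<^bsub>M\<^esub>, \<one>\<^bsub>S\<^esub>)\<rparr>"

(* Inf on nat is the least element of a nonempty, possibly infinite, set, whereas Min is meaningful
   only on finite sets. A regular D-class contains an idempotent; if D contains none,
   the value is unspecified. *)
definition twisting_min :: "('s, 'x) monoid_scheme \<Rightarrow> ('s \<Rightarrow> 's \<Rightarrow> nat) \<Rightarrow> 's set \<Rightarrow> nat" where
  "twisting_min S \<Phi> D = Inf {\<Phi> e e | e. e \<in> D \<and> e \<otimes>\<^bsub>S\<^esub> e = e}"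

end

(* (i, a) is regular in the twisted product iff i j q^n i = i for some j, where (M being written
   multiplicatively) n = \<Phi>(a,x) + \<Phi>(ax,a) for some x with axa = a. If q is a unit, the factor q^n
   can be cancelled. Otherwise the element (1, a) forces n = 0, and then \<Phi>(e,e) = 0 for the
   idempotent e = ax, which is R-related to a. Conversely, having an x with n = 0 is inherited along
   L and R by tightness, so it spreads from one idempotent e with \<Phi>(e,e) = 0 to its whole D-class. *)
theory Submission
  imports Defs
begin

lemma regular_semigroup_iff:
  "regular_semigroup X \<longleftrightarrow>
     (\<forall>a\<in>carrier X. \<exists>x\<in>carrier X. a \<otimes>\<^bsub>X\<^esub> x \<otimes>\<^bsub>X\<^esub> a = a)"
  unfolding regular_semigroup_def by metis

section \<open>Green's relations in a monoid\<close>

lemma green_D_subset: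
  assumes "equiv (carrier S) E" "green_L S \<union> green_R S \<subseteq> E"
  shows "green_D S \<subseteq> E"
  using assms unfolding green_D_def by blast

lemma green_R_subset_green_D: "green_R S \<subseteq> green_D S"
  unfolding green_D_def by blast

context monoid
begin

lemma green_L_leftD:
  assumes "(a, b) \<in> green_L G"
  shows "\<exists>u\<in>carrier G. b = u \<otimes> a"
proof -
  have "carrier G #> a = carrier G #> b" and b: "b \<in> carrier G"
    using assms unfolding green_L_def by auto
  moreover have "\<one> \<otimes> b \<in> carrier G #> b"
    unfolding r_coset_def by blast
  ultimately show ?thesis
    unfolding r_coset_def by auto
qed

lemma green_R_rightD:
  assumes "(a, b) \<in> green_R G"
  shows "\<exists>u\<in>carrier G. b = a \<otimes> u"
proof -
  have "a <# carrier G = b <# carrier G" and b: "b \<in> carrier G"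
    using assms unfolding green_R_def by auto
  moreover have "b \<otimes> \<one> \<in> b <# carrier G"
    unfolding l_coset_def by blast
  ultimately show ?thesis
    unfolding l_coset_def by auto
qed

text \<open>Used with \<open>v = a\<close>: for an inner inverse \<open>u\<close> of
  \<open>a\<close>, it puts the idempotent \<open>a \<otimes> u\<close> in the R-class of
  \<open>a\<close>.\<close>

lemma green_R_mult_right:
  assumes "a \<in> carrier G" "u \<in> carrier G" "v \<in> carrier G" "a \<otimes> u \<otimes> v = a"
  shows "(a, a \<otimes> u) \<in> green_R G"
proof -
  have "a \<otimes> s = a \<otimes> u \<otimes> (v \<otimes> s)" if "s \<in> carrier G" for s
    using assms that by (metis m_assoc m_closed)
  then have "a <# carrier G \<subseteq> (a \<otimes> u) <# carrier G"
    using assms(3) unfolding l_coset_def by blast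
  moreover have "a \<otimes> u \<otimes> s = a \<otimes> (u \<otimes> s)" if "s \<in> carrier G" for s
    using assms that by (simp add: m_assoc)
  then have "(a \<otimes> u) <# carrier G \<subseteq> a <# carrier G"
    using assms(2) unfolding l_coset_def by blast
  ultimately show ?thesis
    using assms unfolding green_R_def by auto
qed

lemma sym_green_L: "(a, b) \<in> green_L G \<Longrightarrow> (b, a) \<in> green_L G"
  unfolding green_L_def by auto

lemma sym_green_R: "(a, b) \<in> green_R G \<Longrightarrow> (b, a) \<in> green_R G"
  unfolding green_R_def by auto

text \<open>The pairs on which \<open>P\<close> agrees form an equivalence on the carrier, so it
  contains the join once it contains L and R. As L and R are symmetric, preservation of
  \<open>P\<close> in one direction suffices.\<close>

lemma green_D_invariant:
  assumes "(a, b) \<in> green_D G"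
    and "\<And>a b. (a, b) \<in> green_L G \<Longrightarrow> P a \<Longrightarrow> P b"
    and "\<And>a b. (a, b) \<in> green_R G \<Longrightarrow> P a \<Longrightarrow> P b"
  shows "P a \<longleftrightarrow> P b"
proof -
  let ?E = "{(a, b) \<in> carrier G \<times> carrier G. P a \<longleftrightarrow> P b}"
  have "equiv (carrier G) ?E"
    by (auto simp: equiv_def refl_on_def sym_def trans_def)
  moreover have "green_L G \<union> green_R G \<subseteq> ?E"
  proof
    fix p assume "p \<in> green_L G \<union> green_R G"
    then obtain a b where p: "p = (a, b)" and ab: "(a, b) \<in> green_L G \<or> (a, b) \<in> green_R G"
      by (cases p) auto
    then have "P a \<longleftrightarrow> P b"
      using assms(2,3) sym_green_L sym_green_R by blast
    moreover have "a \<in> carrier G" "b \<in> carrier G"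
      using ab unfolding green_L_def green_R_def by auto
    ultimately show "p \<in> ?E"
      using p by simp
  qed
  ultimately show ?thesis
    using assms(1) green_D_subset by blast
qed

end

section \<open>Units and powers\<close>

lemma (in monoid) Units_nat_pow_closed:
  "q \<in> Units G \<Longrightarrow> q [^] (n :: nat) \<in> Units G"
  by (induction n) auto

text \<open>The exponent is positive, so one factor \<open>q\<close> can be split off;
  \<open>j \<otimes> q [^] n\<close> is then its inverse.\<close>

lemma (in comm_monoid) Units_of_pow_Suc:
  assumes "q \<in> carrier G" "j \<in> carrier G" "j \<otimes> q [^] Suc n = \<one>"
  shows "q \<in> Units G"
proof -
  have "(j \<otimes> q [^] n) \<otimes> q = \<one>"
    using assms by (simp add: m_assoc)
  then show ?thesis
    using assms(1,2) m_comm unfolding Units_def by fastforce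
qed

section \<open>Tight twistings and Green's relations\<close>

locale tightly_twisted_monoid = monoid S for S (structure) +
  fixes \<Phi> :: "'a \<Rightarrow> 'a \<Rightarrow> nat"
  assumes tight: "tight_twisting S \<Phi>"
begin

lemma cocycle:
  assumes "a \<in> carrier S" "b \<in> carrier S" "c \<in> carrier S"
  shows "\<Phi> a b + \<Phi> (a \<otimes> b) c = \<Phi> a (b \<otimes> c) + \<Phi> b c"
  using tight assms unfolding tight_twisting_def twisting_def by blast

lemma tight_left:
  assumes "a \<in> carrier S" "b \<in> carrier S"
  obtains a' where "a' \<in> carrier S" "a \<otimes> b = a' \<otimes> b" "\<Phi> a' b = 0"
  using tight assms unfolding tight_twisting_def by blast

lemma tight_right:
  assumes "a \<in> carrier S" "b \<in> carrier S"
  obtains b' where "b' \<in> carrier S" "a \<otimes> b = a \<otimes> b'" "\<Phi> a b' = 0"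
  using tight assms unfolding tight_twisting_def by blast

text \<open>The two zeros say that no power of \<open>q\<close> enters the product (i,a)(j,x)(i,a)
  in the twisted product.\<close>

definition untwisted_inverse :: "'a \<Rightarrow> 'a \<Rightarrow> bool" where
  "untwisted_inverse a x \<longleftrightarrow>
     x \<in> carrier S \<and> a \<otimes> x \<otimes> a = a \<and> \<Phi> a x = 0 \<and> \<Phi> (a \<otimes> x) a = 0"

text \<open>Write b = ua and a = vb. Then xv is an inner inverse of b, since b(xv)b = bxa = uaxa =
  ua = b. The cocycle identity carries the zeros along, because a sum of naturals vanishes only if
  each term does.\<close>

lemma untwisted_inverse_green_L:
  assumes L: "(a, b) \<in> green_L S" and x: "untwisted_inverse a x"
  shows "\<exists>y. untwisted_inverse b y"
proof -
  have ab: "a \<in> carrier S" "b \<in> carrier S"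
    using L unfolding green_L_def by auto
  have xS: "x \<in> carrier S" and axa: "a \<otimes> (x \<otimes> a) = a"
    using x ab unfolding untwisted_inverse_def by (auto simp: m_assoc)
  \<comment> \<open>Rebracketing (ax)a as a(xa): b arises from a by multiplying on the left, so the
    zeros are needed in this form.\<close>
  have zero: "\<Phi> a (x \<otimes> a) = 0" "\<Phi> x a = 0"
    using cocycle [of a x a] x ab unfolding untwisted_inverse_def by auto
  \<comment> \<open>Tightness replaces the multiplier given by L with one that has the same product
    with \<open>a\<close> and twist 0.\<close>
  obtain u where u: "u \<in> carrier S" "b = u \<otimes> a" "\<Phi> u a = 0"
    using green_L_leftD [OF L] tight_left ab by metis
  obtain v where v: "v \<in> carrier S" "a = v \<otimes> b" "\<Phi> v b = 0"
    using green_L_leftD [OF sym_green_L [OF L]] tight_left ab by metis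
  have xvb: "x \<otimes> v \<otimes> b = x \<otimes> a"
    using m_assoc [OF xS v(1) ab(2)] unfolding v(2) [symmetric] .
  have bxa: "b \<otimes> (x \<otimes> a) = b"
    using m_assoc [of u a "x \<otimes> a"] u(1) xS ab(1) axa unfolding u(2) by simp
  have 1: "\<Phi> (x \<otimes> v) b = 0"
    using cocycle [OF xS v(1) ab(2)] v(3) zero(2) unfolding v(2) [symmetric] by simp
  have 2: "\<Phi> b (x \<otimes> a) = 0"
    using cocycle [of u a "x \<otimes> a"] u xS ab(1) zero axa by simp
  \<comment> \<open>By the cocycle identity this sum is
    \<open>\<Phi> b (x \<otimes> a) + \<Phi> (x \<otimes> v) b\<close>, and both terms are
    0.\<close>
  have "\<Phi> b (x \<otimes> v) + \<Phi> (b \<otimes> (x \<otimes> v)) b = 0"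
    using cocycle [of b "x \<otimes> v" b] xS v(1) ab 1 2 xvb by simp
  moreover have "b \<otimes> (x \<otimes> v) \<otimes> b = b"
    using bxa xvb xS v(1) ab by (simp add: m_assoc)
  ultimately show ?thesis
    using xS v(1) unfolding untwisted_inverse_def by auto
qed

text \<open>With b = au and a = bv the witness is vx. Since b(vx) = ax, the second zero to check is
  \<open>\<Phi> (a \<otimes> x) b\<close>; the left bracketing in \<open>untwisted_inverse\<close>
  already fits right multiplication.\<close>

lemma untwisted_inverse_green_R:
  assumes R: "(a, b) \<in> green_R S" and x: "untwisted_inverse a x"
  shows "\<exists>y. untwisted_inverse b y"
proof -
  have ab: "a \<in> carrier S" "b \<in> carrier S"
    using R unfolding green_R_def by auto
  have xS: "x \<in> carrier S" and axa: "a \<otimes> x \<otimes> a = a"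
    and zero: "\<Phi> a x = 0" "\<Phi> (a \<otimes> x) a = 0"
    using x unfolding untwisted_inverse_def by auto
  obtain u where u: "u \<in> carrier S" "b = a \<otimes> u" "\<Phi> a u = 0"
    using green_R_rightD [OF R] tight_right ab by metis
  obtain v where v: "v \<in> carrier S" "a = b \<otimes> v" "\<Phi> b v = 0"
    using green_R_rightD [OF sym_green_R [OF R]] tight_right ab by metis
  have bvx: "b \<otimes> (v \<otimes> x) = a \<otimes> x"
    using m_assoc [OF ab(2) v(1) xS] unfolding v(2) [symmetric] by simp
  have "\<Phi> b (v \<otimes> x) = 0"
    using cocycle [OF ab(2) v(1) xS] v(3) zero(1) unfolding v(2) [symmetric] by simp
  moreover have "\<Phi> (a \<otimes> x) b = 0"
    using cocycle [of "a \<otimes> x" a u] u xS ab(1) zero axa by simp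
  moreover have "b \<otimes> (v \<otimes> x) \<otimes> b = b"
    using m_assoc [of "a \<otimes> x" a u] bvx axa u(1) xS ab(1) unfolding u(2) by simp
  ultimately show ?thesis
    using xS v(1) bvx unfolding untwisted_inverse_def by auto
qed

text \<open>In the cocycle identity for ax, a, x the left side is
  \<open>\<Phi> (a \<otimes> x) a + \<Phi> a x\<close>, because axa = a.\<close>

lemma untwisted_inverse_idem:
  assumes "a \<in> carrier S" "untwisted_inverse a x"
  shows "\<Phi> (a \<otimes> x) (a \<otimes> x) = 0"
  using cocycle [of "a \<otimes> x" a x] assms unfolding untwisted_inverse_def by auto

lemma idem_in_green_D_class:
  assumes "a \<in> carrier S" "x \<in> carrier S" "a \<otimes> x \<otimes> a = a"
  shows "a \<otimes> x \<in> green_D S `` {a}" "a \<otimes> x \<otimes> (a \<otimes> x) = a \<otimes> x"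
proof -
  show "a \<otimes> x \<in> green_D S `` {a}"
    using green_R_mult_right [OF assms(1,2,1,3)] green_R_subset_green_D by blast
  show "a \<otimes> x \<otimes> (a \<otimes> x) = a \<otimes> x"
    using assms by (metis m_assoc m_closed)
qed

lemma twisting_min_eq_0_if_untwisted_inverse:
  assumes "a \<in> carrier S" "untwisted_inverse a x"
  shows "twisting_min S \<Phi> (green_D S `` {a}) = 0"
proof -
  have "x \<in> carrier S" "a \<otimes> x \<otimes> a = a"
    using assms unfolding untwisted_inverse_def by auto
  note e = idem_in_green_D_class [OF assms(1) this]
  have "0 \<in> {\<Phi> e e | e. e \<in> green_D S `` {a} \<and> e \<otimes> e = e}"
    using e untwisted_inverse_idem [OF assms] by force
  then show ?thesis
    unfolding twisting_min_def Inf_nat_def by (rule Least_eq_0)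
qed

lemma untwisted_inverse_if_twisting_min_eq_0:
  assumes "a \<in> carrier S" "x \<in> carrier S" "a \<otimes> x \<otimes> a = a"
    and "twisting_min S \<Phi> (green_D S `` {a}) = 0"
  shows "\<exists>y. untwisted_inverse a y"
proof -
  let ?A = "{\<Phi> e e | e. e \<in> green_D S `` {a} \<and> e \<otimes> e = e}"
  \<comment> \<open>The infimum is attained on a nonempty set of naturals; the idempotent
    \<open>a \<otimes> x\<close> supplies a member.\<close>
  have "?A \<noteq> {}"
    using idem_in_green_D_class [OF assms(1-3)] by blast
  then have "Inf ?A \<in> ?A"
    by (rule Inf_nat_def1)
  then obtain e where e: "(a, e) \<in> green_D S" "e \<otimes> e = e" "\<Phi> e e = 0"
    using assms(4) unfolding twisting_min_def by auto
  \<comment> \<open>The full relation is an equivalence above L and R; this places \<open>e\<close>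
    in the carrier.\<close>
  have "equiv (carrier S) (carrier S \<times> carrier S)"
    by (auto simp: equiv_def refl_on_def sym_def trans_def)
  then have "green_D S \<subseteq> carrier S \<times> carrier S"
    by (rule green_D_subset) (auto simp: green_L_def green_R_def)
  \<comment> \<open>As eee = e, both twists of the pair reduce to \<open>\<Phi> e e\<close>.\<close>
  then have "untwisted_inverse e e"
    using e unfolding untwisted_inverse_def by auto
  then show ?thesis
    using green_D_invariant [OF e(1), of "\<lambda>a. \<exists>y. untwisted_inverse a y"]
      untwisted_inverse_green_L untwisted_inverse_green_R by blast
qed

end

section \<open>Regularity of the twisted product\<close>

lemma (in comm_monoid) regular_twisted_product_iff:
  assumes "q \<in> carrier G"
  shows "regular_semigroup (twisted_product G q \<Phi> S) \<longleftrightarrow>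
     (\<forall>i\<in>carrier G. \<forall>a\<in>carrier S. \<exists>j\<in>carrier G. \<exists>x\<in>carrier S.
        i \<otimes> (j \<otimes> q [^] (\<Phi> a x + \<Phi> (a \<otimes>\<^bsub>S\<^esub> x) a)) \<otimes> i = i \<and> a \<otimes>\<^bsub>S\<^esub> x \<otimes>\<^bsub>S\<^esub> a = a)"
proof -
  have "i \<otimes> j \<otimes> q [^] m \<otimes> i \<otimes> q [^] n = i \<otimes> (j \<otimes> q [^] (m + n)) \<otimes> i"
    if "i \<in> carrier G" "j \<in> carrier G" for i j and m n :: nat
    using that assms by (simp add: nat_pow_mult [symmetric] m_ac)
  then show ?thesis
    unfolding regular_semigroup_iff twisted_product_def by simp
qed

theorem theorem7p4:
  fixes S :: "('s, 'x) monoid_scheme"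
    and M :: "('m, 'y) monoid_scheme"
    and q :: 'm
    and \<Phi> :: "'s \<Rightarrow> 's \<Rightarrow> nat"
  assumes "monoid S"
    and "comm_monoid M"
    and "q \<in> carrier M"
    and "tight_twisting S \<Phi>"
  shows "regular_semigroup (twisted_product M q \<Phi> S) \<longleftrightarrow>
    regular_semigroup M \<and> regular_semigroup S \<and>
    (q \<in> Units M \<or> (\<forall>D \<in> carrier S // green_D S. twisting_min S \<Phi> D = 0))"
proof -
  interpret M: comm_monoid M by fact
  interpret T: tightly_twisted_monoid S \<Phi>
    using assms by (simp add: tightly_twisted_monoid.intro tightly_twisted_monoid_axioms.intro)
  have q: "q \<in> carrier M" by fact
  note iff = M.regular_twisted_product_iff [OF q, of \<Phi> S]
  show ?thesis
  proof
    assume *: "regular_semigroup (twisted_product M q \<Phi> S)"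
    have reg: "\<exists>j\<in>carrier M. \<exists>x\<in>carrier S.
        i \<otimes>\<^bsub>M\<^esub> (j \<otimes>\<^bsub>M\<^esub> q [^]\<^bsub>M\<^esub> (\<Phi> a x + \<Phi> (a \<otimes>\<^bsub>S\<^esub> x) a)) \<otimes>\<^bsub>M\<^esub> i = i \<and>
        a \<otimes>\<^bsub>S\<^esub> x \<otimes>\<^bsub>S\<^esub> a = a"
      if "i \<in> carrier M" "a \<in> carrier S" for i a
      using * that unfolding iff by blast
    have "regular_semigroup S"
      using reg [OF M.one_closed] unfolding regular_semigroup_iff by blast
    \<comment> \<open>Take \<open>a\<close> to be the identity of \<open>S\<close>: the element
      \<open>j\<close> times the power of \<open>q\<close> is an inner inverse of
      \<open>i\<close>.\<close>
    moreover have "regular_semigroup M"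
      unfolding regular_semigroup_iff
      using reg [OF _ T.one_closed] q by (metis M.m_closed M.nat_pow_closed)
    moreover have "twisting_min S \<Phi> D = 0" if nonunit: "q \<notin> Units M" and DS: "D \<in> carrier S // green_D S" for D
    proof -
      obtain a where a: "a \<in> carrier S" and D: "D = green_D S `` {a}"
        using DS by (rule quotientE)
      \<comment> \<open>Choosing the identity of \<open>M\<close> as first coordinate turns
        regularity into invertibility of the power of \<open>q\<close>.\<close>
      obtain j x where jx: "j \<in> carrier M" "x \<in> carrier S" "a \<otimes>\<^bsub>S\<^esub> x \<otimes>\<^bsub>S\<^esub> a = a"
        and eq: "\<one>\<^bsub>M\<^esub> \<otimes>\<^bsub>M\<^esub> (j \<otimes>\<^bsub>M\<^esub> q [^]\<^bsub>M\<^esub> (\<Phi> a x + \<Phi> (a \<otimes>\<^bsub>S\<^esub> x) a)) \<otimes>\<^bsub>M\<^esub> \<one>\<^bsub>M\<^esub> = \<one>\<^bsub>M\<^esub>"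
        using reg [OF M.one_closed a] by blast
      have "\<Phi> a x + \<Phi> (a \<otimes>\<^bsub>S\<^esub> x) a = 0"
      proof (rule ccontr)
        assume "\<Phi> a x + \<Phi> (a \<otimes>\<^bsub>S\<^esub> x) a \<noteq> 0"
        then obtain n where n: "\<Phi> a x + \<Phi> (a \<otimes>\<^bsub>S\<^esub> x) a = Suc n"
          using not0_implies_Suc by blast
        have "j \<otimes>\<^bsub>M\<^esub> q [^]\<^bsub>M\<^esub> Suc n = \<one>\<^bsub>M\<^esub>"
          using eq jx q unfolding n by (simp del: nat_pow_Suc)
        then have "q \<in> Units M"
          using M.Units_of_pow_Suc q jx by blast
        with nonunit show False by simp
      qed
      then have "T.untwisted_inverse a x"
        using jx unfolding T.untwisted_inverse_def by simp
      then show ?thesis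
        unfolding D by (rule T.twisting_min_eq_0_if_untwisted_inverse [OF a])
    qed
    ultimately show "regular_semigroup M \<and> regular_semigroup S \<and>
        (q \<in> Units M \<or> (\<forall>D \<in> carrier S // green_D S. twisting_min S \<Phi> D = 0))"
      by blast
  next
    assume *: "regular_semigroup M \<and> regular_semigroup S \<and>
      (q \<in> Units M \<or> (\<forall>D \<in> carrier S // green_D S. twisting_min S \<Phi> D = 0))"
    have "\<exists>j\<in>carrier M. \<exists>x\<in>carrier S.
        i \<otimes>\<^bsub>M\<^esub> (j \<otimes>\<^bsub>M\<^esub> q [^]\<^bsub>M\<^esub> (\<Phi> a x + \<Phi> (a \<otimes>\<^bsub>S\<^esub> x) a)) \<otimes>\<^bsub>M\<^esub> i = i \<and>
        a \<otimes>\<^bsub>S\<^esub> x \<otimes>\<^bsub>S\<^esub> a = a"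
      if i: "i \<in> carrier M" and a: "a \<in> carrier S" for i a
    proof -
      obtain k where k: "k \<in> carrier M" "i \<otimes>\<^bsub>M\<^esub> k \<otimes>\<^bsub>M\<^esub> i = i"
        using * i unfolding regular_semigroup_iff by blast
      obtain x where x: "x \<in> carrier S" "a \<otimes>\<^bsub>S\<^esub> x \<otimes>\<^bsub>S\<^esub> a = a"
        using * a unfolding regular_semigroup_iff by blast
      show ?thesis
      proof (cases "q \<in> Units M")
        case True
        define p where "p = q [^]\<^bsub>M\<^esub> (\<Phi> a x + \<Phi> (a \<otimes>\<^bsub>S\<^esub> x) a)"
        have p: "p \<in> Units M"
          unfolding p_def using True by (rule M.Units_nat_pow_closed)
        \<comment> \<open>The witness for \<open>j\<close> is \<open>k\<close> times the inverse of
          \<open>p\<close>, which cancels the power of \<open>q\<close> produced by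
          \<open>x\<close>.\<close>
        have "k \<otimes>\<^bsub>M\<^esub> inv\<^bsub>M\<^esub> p \<otimes>\<^bsub>M\<^esub> p = k"
          using p k M.Units_closed [OF p] by (simp add: M.m_assoc)
        then show ?thesis
          using k x p M.m_closed [OF k(1) M.Units_inv_closed [OF p]] unfolding p_def by metis
      next
        case False
        then have "twisting_min S \<Phi> (green_D S `` {a}) = 0"
          using * a by (blast intro: quotientI)
        then obtain y where "T.untwisted_inverse a y"
          using T.untwisted_inverse_if_twisting_min_eq_0 a x by blast
        \<comment> \<open>The exponent for \<open>y\<close> is 0, so \<open>k\<close> itself serves
          as \<open>j\<close>.\<close>
        then show ?thesis
          using k unfolding T.untwisted_inverse_def by (metis M.nat_pow_0 M.r_one add_0)
      qed
    qed
    then show "regular_semigroup (twisted_product M q \<Phi> S)"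
      unfolding iff by blast
  qed
qed

end
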